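(* Let $k \ge 1$ and consider a hierarchical chain with multi-level abstention (HCMA) $\mathcal{M}_1 \rightarrow \mathcal{M}_2 \rightarrow \cdots \rightarrow \mathcal{M}_k$ with rejection thresholds $\{r_j\}_{j=1}^{k}$, acceptance thresholds $\{a_j\}_{j=1}^{k-1}$ (with $r_j \le a_j$ for $j<k$), and model-specific costs $c_1,\dots,c_k$. Let $p(x,y)$ be the true joint distribution of queries $x$ and ground truth responses $y$. Let $\pi_j$ denote the action chosen by the policy of $\mathcal{M}_j$ on query $x$, let $Y_j$ be the response of the $j$-th model on query $x$, and let $C_j = \sum_{\xi=1}^{j} c_\xi$. Then the probability of error, the probability of abstention, and the expected cost of the HCMA under $(x,y)\sim p(x,y)$ are $$\mathbb{P}(\text{Error}) = \sum_{j=1}^{k} \mathbb{P}_{(x,y)\sim p(x,y)}\big(\pi_1=\texttt{DELEGATE},\dots,\pi_{j-1}=\texttt{DELEGATE},\ \pi_j=\texttt{ACCEPT},\ Y_j\neq y\big),$$ $$\mathbb{P}(\text{Abstain}) = \sum_{j=1}^{k} \mathbb{P}_{(x,y)\sim p(x,y)}\big(\pi_1=\texttt{DELEGATE},\dots,\pi_{j-1}=\texttt{DELEGATE},\ \pi_j=\texttt{REJECT}\big),$$ $$\mathbb{E}[\text{Cost}] = \sum_{j=1}^{k} \mathbb{P}_{(x,y)\sim p(x,y)}\big(\pi_1=\texttt{DELEGATE},\dots,\pi_{j-1}=\texttt{DELEGATE},\ \pi_j\neq\texttt{DELEGATE}\big)\, C_j.$$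
   Context: An HCMA is a chain of models $\mathcal{M}_1 \rightarrow \cdots \rightarrow \mathcal{M}_k$. Each model $\mathcal{M}_j$ has a real-valued function $\hat p_{\mathcal{M}_j}(x)$ of the query $x$ (its estimated probability of correctness on $x$) and produces a response $Y_j = Y_j(x)$ (both measurable functions of $x$). For $j<k$ the policy of $\mathcal{M}_j$ is $$\pi_j = \begin{cases}\texttt{REJECT} & \text{if } \hat p_{\mathcal{M}_j}(x) < r_j,\\ \texttt{DELEGATE} & \text{if } r_j \le \hat p_{\mathcal{M}_j}(x) < a_j,\\ \texttt{ACCEPT} & \text{if } \hat p_{\mathcal{M}_j}(x)\ge a_j.\end{cases}$$ The last model cannot delegate: $\pi_k = \texttt{REJECT}$ if $\hat p_{\mathcal{M}_k}(x) < r_k$ and $\pi_k=\texttt{ACCEPT}$ if $\hat p_{\mathcal{M}_k}(x)\ge r_k$. A query is processed as follows. It is first sent to $\mathcal{M}_1$. When $\mathcal{M}_j$ receives the query it incurs cost $c_j$ and takes action $\pi_j$: on $\texttt{DELEGATE}$ the query is passed to $\mathcal{M}_{j+1}$; on $\texttt{ACCEPT}$ processing stops and the chain outputs $Y_j$; on $\texttt{REJECT}$ processing stops and the whole chain abstains (gives no answer). "Error" is the event that the chain outputs an answer that differs from the ground truth $y$. "Abstain" is the event that the chain abstains. "Cost" is the total cost incurred by all models that received the query. For $j=1$ the list of conditions $\pi_1=\texttt{DELEGATE},\dots,\pi_{j-1}=\texttt{DELEGATE}$ is empty. *)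

theory Defs
  imports "HOL-Probability.Probability"
begin

datatype action = Reject | Delegate | Accept

datatype 'y outcome = Answer 'y | Abstained

text \<open>
  Models are indexed by \<open>1, \<dots>, chain_length\<close>; the values of the fields at other indices, and of
  \<open>accept_thr\<close> at the last index, play no role.
\<close>

record ('x, 'y) hcma =
  chain_length :: nat
  conf :: "nat \<Rightarrow> 'x \<Rightarrow> real"
  resp :: "nat \<Rightarrow> 'x \<Rightarrow> 'y"
  reject_thr :: "nat \<Rightarrow> real"
  accept_thr :: "nat \<Rightarrow> real"
  cost :: "nat \<Rightarrow> real"

definition policy :: "('x, 'y) hcma \<Rightarrow> nat \<Rightarrow> 'x \<Rightarrow> action" where
  "policy H j x =
    (if j < chain_length H then
       (if conf H j x < reject_thr H j then Reject
        else if conf H j x < accept_thr H j then Delegate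
        else Accept)
     else (if conf H j x < reject_thr H j then Reject else Accept))"

text \<open>
  Processing of a query once it has reached model \<open>j\<close>: the final outcome, together with the cost
  incurred by \<open>j\<close> and by all later models that receive the query.
\<close>

function process_from :: "('x, 'y) hcma \<Rightarrow> nat \<Rightarrow> 'x \<Rightarrow> 'y outcome \<times> real" where
  "process_from H j x =
    (case policy H j x of
       Reject \<Rightarrow> (Abstained, cost H j)
     | Accept \<Rightarrow> (Answer (resp H j x), cost H j)
     | Delegate \<Rightarrow>
         (let (res, c) = process_from H (Suc j) x in (res, cost H j + c)))"
  by pat_completeness auto

termination
  by (relation "Wellfounded.measure (\<lambda>(H, j, x). chain_length H - j)")
     (auto simp: policy_def split: if_splits)

declare process_from.simps [simp del]

definition chain_outcome :: "('x, 'y) hcma \<Rightarrow> 'x \<Rightarrow> 'y outcome" where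
  "chain_outcome H x = fst (process_from H 1 x)"

definition chain_cost :: "('x, 'y) hcma \<Rightarrow> 'x \<Rightarrow> real" where
  "chain_cost H x = snd (process_from H 1 x)"

definition error_event :: "('x, 'y) hcma \<Rightarrow> ('x \<times> 'y) measure \<Rightarrow> ('x \<times> 'y) set" where
  "error_event H p = {(x, y) \<in> space p. \<exists>z. chain_outcome H x = Answer z \<and> z \<noteq> y}"

definition abstain_event :: "('x, 'y) hcma \<Rightarrow> ('x \<times> 'y) measure \<Rightarrow> ('x \<times> 'y) set" where
  "abstain_event H p = {(x, y) \<in> space p. chain_outcome H x = Abstained}"

end

theory Submission
  imports Defs
begin

text \<open>
  Every query is stopped by exactly one model \<open>j\<close> of the chain, and the outcome and the cost of the
  query are determined by \<open>j\<close>. So the events ``stopped by \<open>j\<close>'' partition the sample space, and the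
  three formulas are finite additivity over this partition.
\<close>

definition stops_at :: "('x, 'y) hcma \<Rightarrow> nat \<Rightarrow> 'x \<Rightarrow> bool" where
  "stops_at H j x \<longleftrightarrow> (\<forall>i\<in>{1..<j}. policy H i x = Delegate) \<and> policy H j x \<noteq> Delegate"

text \<open>For \<open>i < j\<close>, stopping at \<open>j\<close> makes model \<open>i\<close>
  delegate, against stopping at \<open>i\<close>. The bounds \<open>1 \<le> i\<close> and
  \<open>1 \<le> j\<close> matter because \<open>{1..<j}\<close> never reaches index 0.\<close>

lemma stops_at_unique:
  assumes "stops_at H i x" "stops_at H j x" "1 \<le> i" "1 \<le> j"
  shows "i = j"
  using assms unfolding stops_at_def by (cases i j rule: linorder_cases) auto

text \<open>The last model cannot delegate, so a least non-delegating index exists within the chain;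
  minimality makes all earlier models delegate.\<close>

lemma ex_stops_at:
  assumes "1 \<le> chain_length H"
  shows "\<exists>j\<in>{1..chain_length H}. stops_at H j x"
proof -
  let ?P = "\<lambda>j. 1 \<le> j \<and> policy H j x \<noteq> Delegate"
  have last: "?P (chain_length H)"
    using assms by (auto simp: policy_def)
  have "?P (Least ?P)"
    using last by (rule LeastI)
  moreover have "Least ?P \<le> chain_length H"
    using last by (rule Least_le)
  moreover have "policy H i x = Delegate" if "i \<in> {1..<Least ?P}" for i
    using that not_less_Least[of i ?P] by auto
  ultimately show ?thesis
    unfolding stops_at_def by (metis atLeastAtMost_iff)
qed

text \<open>Existence and uniqueness in one elimination rule: within the chain,
  \<open>stops_at H i x\<close> becomes the equation \<open>i = j\<close>, which collapses
  quantifiers and sums over indices.\<close>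

lemma stops_at_cases:
  assumes "1 \<le> chain_length H"
  obtains j where "j \<in> {1..chain_length H}"
    "\<And>i. i \<in> {1..chain_length H} \<Longrightarrow> stops_at H i x \<longleftrightarrow> i = j"
proof -
  obtain j where j: "j \<in> {1..chain_length H}" "stops_at H j x"
    using ex_stops_at[OF assms] by blast
  have "stops_at H i x \<longleftrightarrow> i = j" if "i \<in> {1..chain_length H}" for i
    using stops_at_unique[of H i x j] that j by (metis atLeastAtMost_iff)
  with j(1) show thesis
    by (rule that)
qed

text \<open>The recursion moves the starting model from \<open>m\<close> to \<open>Suc m\<close>
  while the stopping model \<open>j\<close> stays fixed. A general \<open>m\<close> in place of 1
  therefore allows induction downwards from \<open>m = j\<close>.\<close>

lemma process_from_stop:
  assumes "m \<le> j" "\<forall>i\<in>{m..<j}. policy H i x = Delegate" "policy H j x \<noteq> Delegate"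
  shows "process_from H m x =
    (if policy H j x = Accept then Answer (resp H j x) else Abstained, \<Sum>i=m..j. cost H i)"
  using assms
proof (induction m rule: inc_induct)
  case base
  then show ?case
    by (subst process_from.simps) (auto split: action.split)
next
  case (step m)
  then have "policy H m x = Delegate"
    by auto
  moreover have "(\<Sum>i=m..j. cost H i) = cost H m + (\<Sum>i=Suc m..j. cost H i)"
    using step.hyps by (simp add: sum.atLeast_Suc_atMost)
  ultimately show ?case
    using step by (subst process_from.simps) simp
qed

lemma
  assumes "stops_at H j x" "1 \<le> j"
  shows chain_outcome_stop:
      "chain_outcome H x = (if policy H j x = Accept then Answer (resp H j x) else Abstained)"
    and chain_cost_stop: "chain_cost H x = (\<Sum>i=1..j. cost H i)"
  using process_from_stop[of 1 j H x] assms
  unfolding chain_outcome_def chain_cost_def stops_at_def by auto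

lemma pred_policy [measurable]:
  assumes [measurable]: "conf H j \<in> borel_measurable M"
  shows "Measurable.pred M (\<lambda>x. policy H j x = a)"
  unfolding policy_def by measurable

text \<open>Shared by the error and the abstention formula. \<open>f\<close> extracts the query from
  a sample point, and since \<open>Q j\<close> implies stopping at \<open>j\<close>, uniqueness of
  the stopping index makes the pieces disjoint.\<close>

lemma (in prob_space) stopped_event_partition:
  fixes H :: "('x, 'y) hcma"
  assumes "\<And>j. j \<in> {1..k} \<Longrightarrow> {z \<in> space M. Q j z} \<in> events"
    and "\<And>j z. j \<in> {1..k} \<Longrightarrow> Q j z \<Longrightarrow> stops_at H j (f z)"
    and "A = (\<Union>j\<in>{1..k}. {z \<in> space M. Q j z})"
  shows "A \<in> events \<and> prob A = (\<Sum>j=1..k. prob {z \<in> space M. Q j z})"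
proof -
  have "disjoint_family_on (\<lambda>j. {z \<in> space M. Q j z}) {1..k}"
    unfolding disjoint_family_on_def
  proof (intro ballI impI equals0I)
    fix i j z
    assume "i \<in> {1..k}" "j \<in> {1..k}" "i \<noteq> j"
      and "z \<in> {z \<in> space M. Q i z} \<inter> {z \<in> space M. Q j z}"
    then show False
      using assms(2)[of i z] assms(2)[of j z] stops_at_unique[of H i "f z" j] by simp
  qed
  then show ?thesis
    using assms(1) unfolding assms(3)
    by (auto intro!: finite_measure_finite_Union sets.finite_UN)
qed

theorem proposition2:
  fixes H :: "('x, 'y) hcma"
    and X :: "'x measure" and R :: "'y measure"
    and p :: "('x \<times> 'y) measure"
    and k :: nat and C :: "nat \<Rightarrow> real"
  assumes k_def: "k = chain_length H"
    and k_ge_1: "k \<ge> 1"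
    and thresholds: "\<And>j. j \<in> {1..<k} \<Longrightarrow> reject_thr H j \<le> accept_thr H j"
    and conf_measurable: "\<And>j. j \<in> {1..k} \<Longrightarrow> conf H j \<in> borel_measurable X"
    and resp_measurable: "\<And>j. j \<in> {1..k} \<Longrightarrow> resp H j \<in> X \<rightarrow>\<^sub>M R"
    and p_prob: "prob_space p"
    and p_joint: "sets p = sets (X \<Otimes>\<^sub>M R)"
    and disagreement_event:
      "\<And>j. j \<in> {1..k} \<Longrightarrow> {(x, y) \<in> space p. resp H j x \<noteq> y} \<in> sets p"
    and C_def: "\<And>j. C j = (\<Sum>i=1..j. cost H i)"
  shows "(error_event H p \<in> sets p \<and>
       measure p (error_event H p) =
         (\<Sum>j=1..k. \<P>((x, y) in p. (\<forall>i\<in>{1..<j}. policy H i x = Delegate) \<and>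
                               policy H j x = Accept \<and> resp H j x \<noteq> y))) \<and>
     (abstain_event H p \<in> sets p \<and>
       measure p (abstain_event H p) =
         (\<Sum>j=1..k. \<P>((x, y) in p. (\<forall>i\<in>{1..<j}. policy H i x = Delegate) \<and>
                               policy H j x = Reject))) \<and>
     (integrable p (\<lambda>(x, y). chain_cost H x) \<and>
       (\<integral>(x, y). chain_cost H x \<partial>p) =
         (\<Sum>j=1..k. \<P>((x, y) in p. (\<forall>i\<in>{1..<j}. policy H i x = Delegate) \<and>
                               policy H j x \<noteq> Delegate) * C j))"
proof -
  interpret prob_space p by (rule p_prob)
  have Collect_pair: "{(x, y). (x, y) \<in> A \<and> P x y} = {z \<in> A. P (fst z) (snd z)}"
    for A :: "('x \<times> 'y) set" and P
    by auto
  let ?D = "\<lambda>j x. \<forall>i\<in>{1..<j}. policy H i x = Delegate"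
  \<comment> \<open>Measurability on the query space is pulled back along \<open>fst\<close>;
    \<open>p\<close> has the sigma-algebra of the product but need not be a product measure.\<close>
  have pol: "Measurable.pred p (\<lambda>z. policy H i (fst z) = a)" if "i \<in> {1..k}" for i a
    using measurable_compose[OF measurable_fst pred_policy[OF conf_measurable[OF that]]]
    by (simp cong: measurable_cong_sets add: measurable_cong_sets[OF p_joint refl])
  have deleg: "Measurable.pred p (\<lambda>z. ?D j (fst z))" if "j \<in> {1..k}" for j
    using that pol by (intro pred_intros_finite) auto
  have stop: thesis
    if "\<And>j. j \<in> {1..k} \<Longrightarrow> stops_at H j x \<Longrightarrow>
      (\<And>i. i \<in> {1..k} \<Longrightarrow> stops_at H i x \<longleftrightarrow> i = j) \<Longrightarrow> thesis"
    for x thesis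
    using that stops_at_cases[of H x] k_ge_1 unfolding k_def by metis
  \<comment> \<open>The diagonal of a general \<open>R\<close> need not be measurable, so this event
    is taken from \<open>disagreement_event\<close>.\<close>
  have dis: "Measurable.pred p (\<lambda>z. resp H j (fst z) \<noteq> snd z)" if "j \<in> {1..k}" for j
    using disagreement_event[OF that] by (simp add: pred_def Collect_pair)
  have error: "error_event H p \<in> events \<and> prob (error_event H p) =
      (\<Sum>j=1..k. prob {z \<in> space p. ?D j (fst z) \<and> policy H j (fst z) = Accept \<and>
        resp H j (fst z) \<noteq> snd z})"
  proof (rule stopped_event_partition[where f = fst and H = H])
    fix j assume j: "j \<in> {1..k}"
    note [measurable] = deleg[OF j] pol[OF j] dis[OF j]
    show "{z \<in> space p. ?D j (fst z) \<and> policy H j (fst z) = Accept \<and>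
        resp H j (fst z) \<noteq> snd z} \<in> events"
      by measurable
  next
    have "(\<exists>r. chain_outcome H x = Answer r \<and> r \<noteq> y) \<longleftrightarrow>
        (\<exists>j\<in>{1..k}. ?D j x \<and> policy H j x = Accept \<and> resp H j x \<noteq> y)" for x y
    proof -
      obtain j where j: "j \<in> {1..k}" "stops_at H j x"
        and uniq: "\<And>i. i \<in> {1..k} \<Longrightarrow> stops_at H i x \<longleftrightarrow> i = j"
        using stop by metis
      \<comment> \<open>Only the stopping index can be a witness, so the union over all models
        reduces to a condition on model \<open>j\<close>.\<close>
      have "(\<exists>i\<in>{1..k}. stops_at H i x \<and> P i) \<longleftrightarrow> P j" for P
        using j(1) uniq by blast
      \<comment> \<open>Accepting already excludes delegating, so the delegation prefix can be
        exchanged for \<open>stops_at\<close>.\<close>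
      moreover have "?D i x \<and> policy H i x = Accept \<and> Q \<longleftrightarrow>
          stops_at H i x \<and> policy H i x = Accept \<and> Q" for i Q
        unfolding stops_at_def by (cases "policy H i x") simp_all
      ultimately show ?thesis
        using j chain_outcome_stop[OF j(2)] by simp
    qed
    then show "error_event H p = (\<Union>j\<in>{1..k}. {z \<in> space p. ?D j (fst z) \<and>
        policy H j (fst z) = Accept \<and> resp H j (fst z) \<noteq> snd z})"
      unfolding error_event_def by (intro set_eqI) (simp add: case_prod_beta conj_commute)
  qed (auto simp: stops_at_def)
  have abstain: "abstain_event H p \<in> events \<and> prob (abstain_event H p) =
      (\<Sum>j=1..k. prob {z \<in> space p. ?D j (fst z) \<and> policy H j (fst z) = Reject})"
  proof (rule stopped_event_partition[where f = fst and H = H])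
    fix j assume j: "j \<in> {1..k}"
    note [measurable] = deleg[OF j] pol[OF j]
    show "{z \<in> space p. ?D j (fst z) \<and> policy H j (fst z) = Reject} \<in> events"
      by measurable
  next
    have "chain_outcome H x = Abstained \<longleftrightarrow>
        (\<exists>j\<in>{1..k}. ?D j x \<and> policy H j x = Reject)" for x
    proof -
      obtain j where j: "j \<in> {1..k}" "stops_at H j x"
        and uniq: "\<And>i. i \<in> {1..k} \<Longrightarrow> stops_at H i x \<longleftrightarrow> i = j"
        using stop by metis
      have "(\<exists>i\<in>{1..k}. stops_at H i x \<and> P i) \<longleftrightarrow> P j" for P
        using j(1) uniq by blast
      moreover have "?D i x \<and> policy H i x = Reject \<longleftrightarrow>
          stops_at H i x \<and> policy H i x = Reject" for i
        unfolding stops_at_def by (cases "policy H i x") simp_all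
      \<comment> \<open>\<open>chain_outcome_stop\<close> yields \<open>Abstained\<close> for every
        action other than \<open>Accept\<close>; with \<open>Delegate\<close> ruled out, only
        \<open>Reject\<close> remains.\<close>
      moreover have "policy H j x \<noteq> Delegate"
        using j(2) by (simp add: stops_at_def)
      ultimately show ?thesis
        using j chain_outcome_stop[OF j(2)] by (cases "policy H j x") simp_all
    qed
    then show "abstain_event H p =
        (\<Union>j\<in>{1..k}. {z \<in> space p. ?D j (fst z) \<and> policy H j (fst z) = Reject})"
      unfolding abstain_event_def by (intro set_eqI) (simp add: case_prod_beta conj_commute)
  qed (auto simp: stops_at_def)
  define S where "S j = {z \<in> space p. stops_at H j (fst z)}" for j
  have S [measurable]: "S j \<in> events" if j: "j \<in> {1..k}" for j
  proof -
    note [measurable] = deleg[OF j] pol[OF j]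
    show ?thesis unfolding S_def stops_at_def by measurable
  qed
  \<comment> \<open>The cost is a simple function on the partition into the sets \<open>S j\<close>,
    with value \<open>C j\<close> on \<open>S j\<close>: exactly one indicator is nonzero at each
    point of the space.\<close>
  have cost_eq: "chain_cost H (fst z) = (\<Sum>j=1..k. indicator (S j) z * C j)"
    if z: "z \<in> space p" for z
  proof -
    obtain j where j: "j \<in> {1..k}" "stops_at H j (fst z)"
      and uniq: "\<And>i. i \<in> {1..k} \<Longrightarrow> stops_at H i (fst z) \<longleftrightarrow> i = j"
      using stop by metis
    have "(\<Sum>i=1..k. indicator (S i) z * C i) = (\<Sum>i=1..k. if i = j then C i else 0)"
      using z uniq by (intro sum.cong) (auto simp: S_def)
    then show ?thesis
      using j chain_cost_stop[OF j(2)] by (simp add: C_def)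
  qed
  \<comment> \<open>\<open>has_bochner_integral\<close> carries integrability and the value
    together; each \<open>S j\<close> has finite measure under a probability measure.\<close>
  have sum_int: "has_bochner_integral p (\<lambda>z. \<Sum>j=1..k. indicator (S j) z * C j)
      (\<Sum>j=1..k. prob (S j) * C j)"
    by (intro has_bochner_integral_sum has_bochner_integral_mult_left
        has_bochner_integral_real_indicator S) (simp_all add: less_top[symmetric])
  have "has_bochner_integral p (\<lambda>z. chain_cost H (fst z)) (\<Sum>j=1..k. prob (S j) * C j)"
    \<comment> \<open>\<open>cost_eq\<close> holds only on \<open>space p\<close>, which is all that
      congruence of the integral asks for.\<close>
    using sum_int by (subst has_bochner_integral_cong[OF refl cost_eq refl])
  then have cost: "integrable p (\<lambda>z. chain_cost H (fst z)) \<and>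
      (\<integral>z. chain_cost H (fst z) \<partial>p) = (\<Sum>j=1..k. prob (S j) * C j)"
    by (auto simp: has_bochner_integral_iff)
  show ?thesis
    using error abstain cost unfolding S_def stops_at_def Collect_pair case_prod_beta
    by (simp add: conj_assoc)
qed

end
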